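(* There are absolute constants such that the following holds. Let $A$ be a finite set of real numbers with $|A| \geq 2$. Then $$\left|\frac{A+A}{A+A}\right| \gg \frac{|A|^{2+1/4}}{|A/A|^{1/8}\,\log |A|}.$$ Consequently, if $\left|\frac{A+A}{A+A}\right| \ll |A|^2$, then $|A/A| \gg \frac{|A|^2}{\log^8 |A|}$; that is, for every constant $C>0$ there is a constant $c>0$ (depending only on $C$) such that every finite set $A\subset\mathbb{R}$ with $|A|\ge 2$ and $\left|\frac{A+A}{A+A}\right| \leq C|A|^2$ satisfies $|A/A| \geq c\,|A|^2/\log^8|A|$.
   Context: For a finite set $A \subset \mathbb{R}$: $\frac{A+A}{A+A} = \left\{ \frac{a+b}{c+d} : a,b,c,d \in A,\ c+d \neq 0 \right\}$ and $A/A = \{a/b : a,b \in A,\ b\neq 0\}$. The notation $f \gg g$ means $f \geq c\, g$ for an absolute constant $c>0$, and $f \ll g$ means $f \leq C g$ for a constant $C$. *)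

theory Defs
  imports Complex_Main
begin

definition ratio_set :: "real set \<Rightarrow> real set" where
  "ratio_set A = {a / b | a b. a \<in> A \<and> b \<in> A \<and> b \<noteq> 0}"

definition sum_ratio_set :: "real set \<Rightarrow> real set" where
  "sum_ratio_set A = {(a + b) / (c + d) | a b c d.
     a \<in> A \<and> b \<in> A \<and> c \<in> A \<and> d \<in> A \<and> c + d \<noteq> 0}"

end

theory Submission
  imports Defs "HOL-Analysis.Convex" "HOL-Analysis.Harmonic_Numbers" "HOL-Computational_Algebra.Polynomial"
begin

text \<open>
  Passing to one sign, let \<open>A\<close> be positive. Cover \<open>A \<times> A\<close> by the lines through the origin with slopes
  in \<open>A/A\<close>; then \<open>(A+A)/(A+A)\<close> consists of the slopes of sums of two points. By pigeonholing there
  is \<open>t\<close>, at least about \<open>|A|\<^sup>2/|A/A|\<close>, such that the number of lines with at least \<open>t\<close> points is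
  about \<open>|A|\<^sup>2/(t log |A|)\<close> or more. Group these lines into clusters of \<open>M\<close> consecutive ones, with
  \<open>M\<close> about \<open>t\<close> to the power \<open>1/8\<close>. Different clusters produce different slopes, and each cluster
  produces about \<open>M\<^sup>2 t\<close> of them: by Cauchy--Schwarz it suffices to bound the number of coincidences
  \<open>(l x + m y)/(x + y) = (k z + n w)/(z + w)\<close>. For fixed \<open>y, w\<close> this is an increasing curve in the
  \<open>(x, z)\<close>-plane, two points lie on at most two such curves, and an incidence bound applies.
\<close>

section \<open>Ranks in finite linear orders and blocks of consecutive elements\<close>

text \<open>Positions start at 0, so \<open>rank_in X x div b\<close> numbers the blocks of
  \<open>b\<close> consecutive elements. The same encoding yields the cells of a grid and the
  clusters of lines.\<close>

definition rank_in :: "'a::linorder set \<Rightarrow> 'a \<Rightarrow> nat" where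
  "rank_in X x = card {y \<in> X. y < x}"

lemma rank_in_less:
  assumes "finite X" "x \<in> X" "x < y"
  shows "rank_in X x < rank_in X y"
  unfolding rank_in_def by (rule psubset_card_mono) (use assms in auto)

lemma rank_in_mono: "finite X \<Longrightarrow> x \<le> y \<Longrightarrow> rank_in X x \<le> rank_in X y"
  unfolding rank_in_def by (rule card_mono) auto

lemma rank_in_less_card: "finite X \<Longrightarrow> x \<in> X \<Longrightarrow> rank_in X x < card X"
  unfolding rank_in_def by (rule psubset_card_mono) auto

lemma bij_betw_rank_in:
  assumes "finite X"
  shows "bij_betw (rank_in X) X {..<card X}"
proof -
  have inj: "inj_on (rank_in X) X"
    by (rule inj_onI) (metis assms linorder_neqE rank_in_less less_irrefl)
  moreover have "rank_in X ` X = {..<card X}"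
    by (rule card_subset_eq) (use inj assms rank_in_less_card in \<open>auto simp: card_image\<close>)
  ultimately show ?thesis by (simp add: bij_betw_def)
qed

lemma card_rank_block:
  assumes "finite X"
  shows "card {x \<in> X. rank_in X x div b = k} = card {i \<in> {..<card X}. i div b = k}"
proof (rule bij_betw_same_card)
  show "bij_betw (rank_in X) {x \<in> X. rank_in X x div b = k} {i \<in> {..<card X}. i div b = k}"
    using bij_betw_rank_in[OF assms] unfolding bij_betw_def
    by (auto intro: inj_on_subset)
qed

lemma div_eq_interval: "b > 0 \<Longrightarrow> {i. i div b = k} = {k * b..<k * b + (b::nat)}"
  by (auto simp: div_nat_eqI algebra_simps dividend_less_times_div)

lemma card_rank_block_le:
  assumes "finite X" "b > 0"
  shows "card {x \<in> X. rank_in X x div b = k} \<le> b"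
proof -
  have "card {i \<in> {..<card X}. i div b = k} \<le> card {k * b..<k * b + b}"
    using div_eq_interval[OF assms(2), of k] by (intro card_mono) auto
  with card_rank_block[OF assms(1)] show ?thesis by simp
qed

lemma card_rank_block_eq:
  assumes "finite X" "b > 0" "Suc k * b \<le> card X"
  shows "card {x \<in> X. rank_in X x div b = k} = b"
proof -
  have "{i \<in> {..<card X}. i div b = k} = {k * b..<k * b + b}"
    using div_eq_interval[OF assms(2), of k] assms(3) by auto
  with card_rank_block[OF assms(1)] show ?thesis by simp
qed

lemma card_same_rank_block_le:
  assumes "finite X" "b > 0"
  shows "card {(x, y) \<in> X \<times> X. rank_in X x div b = rank_in X y div b} \<le> card X * b"
proof -
  have "{(x, y) \<in> X \<times> X. rank_in X x div b = rank_in X y div b}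
      = (SIGMA x:X. {y \<in> X. rank_in X y div b = rank_in X x div b})" by auto
  moreover have "card (SIGMA x:X. {y \<in> X. rank_in X y div b = rank_in X x div b}) \<le> (\<Sum>x\<in>X. b)"
    using assms by (subst card_SigmaI) (auto simp del: sum_constant intro!: sum_mono card_rank_block_le)
  ultimately show ?thesis by simp
qed

section \<open>Incidences between a grid and increasing chains\<close>

text \<open>Keep one representative of every fibre of \<open>f\<close>. Any other point collides
  with the representative of its fibre, and different points give different pairs.\<close>

lemma card_le_image_plus_collisions:
  assumes "finite S"
  shows "card S \<le> card (f ` S) + card {(p, q) \<in> S \<times> S. p \<noteq> q \<and> f p = f q}"
proof -
  define T where "T = inv_into S f ` (f ` S)"
  have T: "T \<subseteq> S" by (auto simp: T_def inv_into_into)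
  have cT: "card T = card (f ` S)"
    unfolding T_def by (rule card_image) (rule inj_on_inv_into, simp)
  have "card (S - T) \<le> card {(p, q) \<in> S \<times> S. p \<noteq> q \<and> f p = f q}"
  proof (rule card_inj_on_le)
    show "inj_on (\<lambda>p. (p, inv_into S f (f p))) (S - T)" by (auto simp: inj_on_def)
    show "(\<lambda>p. (p, inv_into S f (f p))) ` (S - T) \<subseteq> {(p, q) \<in> S \<times> S. p \<noteq> q \<and> f p = f q}"
    proof clarify
      fix p assume p: "p \<in> S" "p \<notin> T"
      hence "inv_into S f (f p) \<in> T" by (auto simp: T_def)
      with p show "(p, inv_into S f (f p)) \<in> S \<times> S \<and> p \<noteq> inv_into S f (f p) \<and> f p = f (inv_into S f (f p))"
        using T by (auto simp: f_inv_into_f)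
    qed
    show "finite {(p, q) \<in> S \<times> S. p \<noteq> q \<and> f p = f q}"
      by (rule finite_subset[of _ "S \<times> S"]) (use assms in auto)
  qed
  moreover have "card S = card T + card (S - T)"
    using T assms by (metis card_Diff_subset card_mono finite_subset le_add_diff_inverse)
  ultimately show ?thesis using cT by simp
qed

text \<open>A Szemeredi--Trotter bound for Cartesian products: cut \<open>X \<times> Z\<close> into cells of side \<open>b\<close>.
  A chain meets few cells, and two of its points in a common cell determine it up to two choices.\<close>

lemma incidence_bound:
  fixes X :: "'a::linorder set" and Z :: "'b::linorder set" and S :: "'c \<Rightarrow> ('a \<times> 'b) set"
  assumes fin: "finite X" "finite Z" "finite G" and b: "b > 0"
    and sub: "\<And>g. g \<in> G \<Longrightarrow> S g \<subseteq> X \<times> Z"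
    and chain: "\<And>g x z x' z'. g \<in> G \<Longrightarrow> (x, z) \<in> S g \<Longrightarrow> (x', z') \<in> S g \<Longrightarrow> x < x' \<longleftrightarrow> z < z'"
    and two: "\<And>p q. p \<in> X \<times> Z \<Longrightarrow> q \<in> X \<times> Z \<Longrightarrow> p \<noteq> q \<Longrightarrow> card {g \<in> G. p \<in> S g \<and> q \<in> S g} \<le> 2"
  shows "(\<Sum>g\<in>G. card (S g)) \<le>
    card G * (card X div b + card Z div b + 1) + 2 * ((card X * b) * (card Z * b))"
proof -
  define cell where "cell = (\<lambda>p. (rank_in X (fst p) div b, rank_in Z (snd p) div b))"
  define D where "D = {(p, q) \<in> (X \<times> Z) \<times> (X \<times> Z). p \<noteq> q \<and> cell p = cell q}"
  have finD: "finite D"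
    by (rule finite_subset[of _ "(X \<times> Z) \<times> (X \<times> Z)"]) (use fin in \<open>auto simp: D_def\<close>)
  \<comment> \<open>Along a chain both cell coordinates are weakly increasing, so a cell met by the
    chain is determined by the sum of its coordinates. This sum takes values from 0 to
    \<open>card X div b + card Z div b\<close>, hence the \<open>+ 1\<close>.\<close>
  have cells: "card (cell ` S g) \<le> card X div b + card Z div b + 1" if g: "g \<in> G" for g
  proof -
    have "card (cell ` S g) \<le> card {..card X div b + card Z div b}"
    proof (rule card_inj_on_le)
      have *: "cell p = cell q"
        if pq: "p \<in> S g" "q \<in> S g" "fst p \<le> fst q" "fst (cell p) + snd (cell p) = fst (cell q) + snd (cell q)" for p q
      proof -
        have "snd p \<le> snd q"
          using chain[OF g, of "fst q" "snd q" "fst p" "snd p"] pq by auto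
        hence "fst (cell p) \<le> fst (cell q)" "snd (cell p) \<le> snd (cell q)"
          using pq fin by (auto simp: cell_def intro!: div_le_mono rank_in_mono)
        with pq(4) show ?thesis by (auto simp: prod_eq_iff)
      qed
      show "inj_on (\<lambda>c. fst c + snd c) (cell ` S g)"
      proof (rule inj_onI)
        fix c d assume "c \<in> cell ` S g" "d \<in> cell ` S g" and cd: "fst c + snd c = fst d + snd d"
        then obtain p q where "p \<in> S g" "c = cell p" "q \<in> S g" "d = cell q" by blast
        with cd show "c = d" using *[of p q] *[of q p] by (cases "fst p \<le> fst q") auto
      qed
      show "(\<lambda>c. fst c + snd c) ` (cell ` S g) \<subseteq> {..card X div b + card Z div b}"
      proof clarsimp
        fix x z assume "(x, z) \<in> S g"
        hence "x \<in> X" "z \<in> Z" using sub[OF g] by auto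
        hence "rank_in X x \<le> card X" "rank_in Z z \<le> card Z"
          using rank_in_less_card fin by (auto intro: less_imp_le)
        thus "fst (cell (x, z)) + snd (cell (x, z)) \<le> card X div b + card Z div b"
          by (auto simp: cell_def intro!: add_mono div_le_mono)
      qed
    qed simp
    thus ?thesis by simp
  qed
  have "(\<Sum>g\<in>G. card (S g)) \<le>
      (\<Sum>g\<in>G. (card X div b + card Z div b + 1) + card {d \<in> D. fst d \<in> S g \<and> snd d \<in> S g})"
  proof (rule sum_mono)
    fix g assume g: "g \<in> G"
    have "finite (S g)" using sub[OF g] fin by (meson finite_SigmaI finite_subset)
    moreover have "{(p, q) \<in> S g \<times> S g. p \<noteq> q \<and> cell p = cell q} = {d \<in> D. fst d \<in> S g \<and> snd d \<in> S g}"
      using sub[OF g] by (auto simp: D_def)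
    ultimately show "card (S g) \<le> (card X div b + card Z div b + 1) + card {d \<in> D. fst d \<in> S g \<and> snd d \<in> S g}"
      using card_le_image_plus_collisions[of "S g" cell] cells[OF g] by simp
  qed
  also have "\<dots> = card G * (card X div b + card Z div b + 1) + (\<Sum>g\<in>G. card {d \<in> D. fst d \<in> S g \<and> snd d \<in> S g})"
    by (subst sum.distrib) (simp only: sum_constant of_nat_id)
  \<comment> \<open>Double counting: instead of the pairs in a common cell on each chain, count the
    chains through each such pair; by \<open>two\<close> there are at most two.\<close>
  also have "(\<Sum>g\<in>G. card {d \<in> D. fst d \<in> S g \<and> snd d \<in> S g})
      = (\<Sum>d\<in>D. card {g \<in> G. fst d \<in> S g \<and> snd d \<in> S g})"
    by (rule sum_multicount_gen) (use fin finD in auto)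
  also have "\<dots> \<le> (\<Sum>d\<in>D. 2)"
    by (rule sum_mono) (auto simp: D_def intro!: two)
  also have "\<dots> = 2 * card D" by simp
  \<comment> \<open>Two points share a cell iff their first coordinates share a block of
    \<open>X\<close> and their second coordinates share a block of \<open>Z\<close>.\<close>
  also have "card D \<le> (card X * b) * (card Z * b)"
  proof -
    let ?X = "{(x, y) \<in> X \<times> X. rank_in X x div b = rank_in X y div b}"
    let ?Z = "{(x, y) \<in> Z \<times> Z. rank_in Z x div b = rank_in Z y div b}"
    have "finite ?X" "finite ?Z"
      by (rule finite_subset[of _ "X \<times> X"], use fin in auto)
         (rule finite_subset[of _ "Z \<times> Z"], use fin in auto)
    hence "card D \<le> card (?X \<times> ?Z)"
      by (intro card_inj_on_le[where f = "\<lambda>((x, z), (x', z')). ((x, x'), (z, z'))"])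
         (auto simp: D_def cell_def inj_on_def)
    also have "\<dots> \<le> (card X * b) * (card Z * b)"
      unfolding card_cartesian_product
      by (intro mult_mono card_same_rank_block_le fin b) auto
    finally show ?thesis .
  qed
  finally show ?thesis by simp
qed

section \<open>Bilinear curves through two given points\<close>

lemma card_quadratic_roots_le:
  fixes a b c :: real
  assumes "a \<noteq> 0 \<or> b \<noteq> 0 \<or> c \<noteq> 0"
  shows "finite {y. a * y\<^sup>2 + b * y + c = 0}" "card {y. a * y\<^sup>2 + b * y + c = 0} \<le> 2"
proof -
  let ?p = "[:c, b, a:]"
  have nz: "?p \<noteq> 0" using assms by auto
  have eq: "{y. a * y\<^sup>2 + b * y + c = 0} = {y. poly ?p y = 0}"
    by (auto simp: algebra_simps power2_eq_square)
  show "finite {y. a * y\<^sup>2 + b * y + c = 0}" using poly_roots_finite[OF nz] eq by simp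
  have "card {y. poly ?p y = 0} \<le> degree ?p" by (rule card_poly_roots_bound[OF nz])
  also have "\<dots> \<le> 2" by simp
  finally show "card {y. a * y\<^sup>2 + b * y + c = 0} \<le> 2" using eq by simp
qed

text \<open>Eliminating \<open>w\<close> from the two equations leaves a nonzero quadratic equation in \<open>y\<close>.\<close>

lemma card_bilinear_curves_le_two:
  fixes \<alpha> \<beta> \<gamma> \<delta> x z x' z' :: real
  assumes det: "\<alpha> * \<delta> \<noteq> \<beta> * \<gamma>" and nz: "\<alpha> * \<beta> \<noteq> 0 \<or> \<gamma> * \<delta> \<noteq> 0"
    and pos: "x > 0" "z > 0" "x' > 0" "z' > 0" and ne: "(x, z) \<noteq> (x', z')"
    and G: "\<And>y w. (y, w) \<in> G \<Longrightarrow> \<alpha> * x * z + \<beta> * x * w + \<gamma> * y * z + \<delta> * y * w = 0 \<and>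
      \<alpha> * x' * z' + \<beta> * x' * w + \<gamma> * y * z' + \<delta> * y * w = 0"
  shows "card G \<le> 2"
proof -
  define a b c where "a = \<gamma> * \<delta> * (z - z')"
    and "b = z * (\<alpha> * \<delta> * x + \<beta> * \<gamma> * x') - z' * (\<alpha> * \<delta> * x' + \<beta> * \<gamma> * x)"
    and "c = \<alpha> * \<beta> * x * x' * (z - z')"
  have quad: "a * y\<^sup>2 + b * y + c = 0" if "(y, w) \<in> G" for y w
  proof -
    have e: "(\<alpha> * x + \<gamma> * y) * z = - w * (\<beta> * x + \<delta> * y)" "(\<alpha> * x' + \<gamma> * y) * z' = - w * (\<beta> * x' + \<delta> * y)"
      using G[OF that] by (simp_all add: algebra_simps)
    have "((\<alpha> * x + \<gamma> * y) * z) * (\<beta> * x' + \<delta> * y) = ((\<alpha> * x' + \<gamma> * y) * z') * (\<beta> * x + \<delta> * y)"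
      unfolding e by (simp only: mult_ac)
    thus ?thesis by (simp add: a_def b_def c_def algebra_simps power2_eq_square)
  qed
  \<comment> \<open>If \<open>z = z'\<close>, then \<open>a\<close> and \<open>c\<close> vanish and
    the determinant keeps \<open>b\<close> nonzero; otherwise \<open>nz\<close> keeps
    \<open>a\<close> or \<open>c\<close> nonzero.\<close>
  have abc: "a \<noteq> 0 \<or> b \<noteq> 0 \<or> c \<noteq> 0"
  proof (cases "z = z'")
    case True
    hence "b = z * (x - x') * (\<alpha> * \<delta> - \<beta> * \<gamma>)" by (simp add: b_def algebra_simps)
    with True ne pos det show ?thesis by auto
  next
    case False
    with nz pos show ?thesis by (auto simp: a_def c_def)
  qed
  \<comment> \<open>It remains to see that \<open>y\<close> determines \<open>w\<close>. Otherwise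
    the positive \<open>x\<close> and \<open>y\<close> would solve both
    \<open>\<beta> * x + \<delta> * y = 0\<close> and
    \<open>\<alpha> * x + \<gamma> * y = 0\<close>, against the nonzero determinant.\<close>
  have "inj_on fst G"
  proof (rule inj_onI, clarsimp)
    fix y w w' assume "(y, w) \<in> G" "(y, w') \<in> G"
    note g = G[OF this(1)] G[OF this(2)]
    show "w = w'"
    proof (rule ccontr)
      assume "w \<noteq> w'"
      moreover have "(w - w') * (\<beta> * x + \<delta> * y) = 0" using g by (simp add: algebra_simps)
      ultimately have 1: "\<beta> * x + \<delta> * y = 0" by simp
      have "z * (\<alpha> * x + \<gamma> * y) = - w * (\<beta> * x + \<delta> * y)" using g by (simp add: algebra_simps)
      with 1 pos have 2: "\<alpha> * x + \<gamma> * y = 0" by simp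
      have "x * (\<alpha> * \<delta> - \<beta> * \<gamma>) = \<delta> * (\<alpha> * x + \<gamma> * y) - \<gamma> * (\<beta> * x + \<delta> * y)"
        by (simp add: algebra_simps)
      with 1 2 pos det show False by simp
    qed
  qed
  hence "card G \<le> card {y. a * y\<^sup>2 + b * y + c = 0}"
    using quad card_quadratic_roots_le(1)[OF abc] by (intro card_inj_on_le[of fst]) auto
  with card_quadratic_roots_le(2)[OF abc] show ?thesis by simp
qed

section \<open>Slopes of sums of two points\<close>

text \<open>The slope of the sum of \<open>(x, l x)\<close> and \<open>(y, m y)\<close>, points on the lines with slopes \<open>l\<close> and \<open>m\<close>.\<close>

definition slope :: "real \<Rightarrow> real \<Rightarrow> real \<Rightarrow> real \<Rightarrow> real" where
  "slope l m x y = (l * x + m * y) / (x + y)"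

lemma slope_between:
  assumes "l < m" "x > 0" "y > 0"
  shows "l < slope l m x y" "slope l m x y < m"
  using assms by (simp_all add: slope_def field_simps)

text \<open>The slope is the average of \<open>l\<close> and \<open>m\<close> with weights
  \<open>x\<close> and \<open>y\<close>. More weight on the smaller value \<open>l\<close> pulls it
  down, which reverses the order.\<close>

lemma slope_less_iff:
  assumes "l < m" "x > 0" "x' > 0" "y > 0"
  shows "slope l m x y < slope l m x' y \<longleftrightarrow> x' < x"
proof -
  have "slope l m x y < slope l m x' y \<longleftrightarrow> 0 < (m - l) * y * (x - x')"
    using assms by (simp add: slope_def divide_simps) (simp add: algebra_simps)
  also have "\<dots> \<longleftrightarrow> x' < x" using assms by (simp add: zero_less_mult_iff mult_less_0_iff)
  finally show ?thesis .
qed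

lemma slope_less_iff':
  assumes "l < m" "x > 0" "y > 0" "y' > 0"
  shows "slope l m x y < slope l m x y' \<longleftrightarrow> y < y'"
proof -
  have "slope l m x y < slope l m x y' \<longleftrightarrow> 0 < (m - l) * x * (y' - y)"
    using assms by (simp add: slope_def divide_simps) (simp add: algebra_simps)
  also have "\<dots> \<longleftrightarrow> y < y'" using assms by (simp add: zero_less_mult_iff mult_less_0_iff)
  finally show ?thesis .
qed

text \<open>Clearing denominators gives the bilinear equation to which
  \<open>card_bilinear_curves_le_two\<close> applies.\<close>

lemma slope_eq_iff:
  assumes "x > 0" "y > 0" "z > 0" "w > 0"
  shows "slope l m x y = slope k n z w \<longleftrightarrow>
    (l - k) * x * z + (l - n) * x * w + (m - k) * y * z + (m - n) * y * w = 0"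
proof -
  have "x + y \<noteq> 0" "z + w \<noteq> 0" using assms by auto
  hence "slope l m x y = slope k n z w \<longleftrightarrow> (l * x + m * y) * (z + w) = (k * z + n * w) * (x + y)"
    by (simp add: slope_def frac_eq_eq)
  also have "\<dots> \<longleftrightarrow> (l - k) * x * z + (l - n) * x * w + (m - k) * y * z + (m - n) * y * w = 0"
    by (auto simp: algebra_simps)
  finally show ?thesis .
qed

section \<open>Coincidences between slopes from two pairs of lines\<close>

text \<open>By strict monotonicity in the last argument, \<open>p\<close> and the first coordinate
  of \<open>q\<close> determine \<open>q\<close>, which leaves three free coordinates.\<close>

lemma card_slope_collisions_same:
  assumes lm: "l < m"
    and fin: "finite X" "finite Y" and pos: "\<And>x. x \<in> X \<union> Y \<Longrightarrow> x > 0"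
    and card: "card X = t" "card Y = t"
  shows "card {(p, q) \<in> (X \<times> Y) \<times> (X \<times> Y). slope l m (fst p) (snd p) = slope l m (fst q) (snd q)} \<le> t ^ 3"
proof -
  let ?E = "{(p, q) \<in> (X \<times> Y) \<times> (X \<times> Y). slope l m (fst p) (snd p) = slope l m (fst q) (snd q)}"
  have "card ?E \<le> card ((X \<times> Y) \<times> X)"
  proof (rule card_inj_on_le)
    show "inj_on (\<lambda>(p, q). (p, fst q)) ?E"
    proof (rule inj_onI)
      fix e e' assume *: "e \<in> ?E" "e' \<in> ?E" and "(\<lambda>(p, q). (p, fst q)) e = (\<lambda>(p, q). (p, fst q)) e'"
      then obtain p z w w' where e: "e = (p, (z, w))" "e' = (p, (z, w'))"
        by (cases e, cases e') auto
      with * have "slope l m z w = slope l m z w'" "z > 0" "w > 0" "w' > 0" using pos by auto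
      hence "w = w'" using slope_less_iff'[OF lm, of z] by (metis linorder_neqE order_less_irrefl)
      with e show "e = e'" by simp
    qed
  qed (use fin in auto)
  thus ?thesis using card by (simp add: card_cartesian_product power3_eq_cube)
qed

text \<open>The coincidences are the incidences between the grid \<open>X \<times> Z\<close> and the
  \<open>t\<^sup>2\<close> curves \<open>S (y, w)\<close>. The block side \<open>b\<close> stays
  free and is fixed only when a whole cluster is treated.\<close>

lemma card_slope_collisions_distinct:
  assumes lm: "l < m" and kn: "k < n" and ne: "(l, m) \<noteq> (k, n)"
    and fin: "finite X" "finite Y" "finite Z" "finite W"
    and pos: "\<And>x. x \<in> X \<union> Y \<union> Z \<union> W \<Longrightarrow> x > 0"
    and card: "card X = t" "card Y = t" "card Z = t" "card W = t" and b: "b > 0"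
  shows "card {(p, q) \<in> (X \<times> Y) \<times> (Z \<times> W). slope l m (fst p) (snd p) = slope k n (fst q) (snd q)}
    \<le> t\<^sup>2 * (2 * (t div b) + 1) + 2 * (t * b)\<^sup>2"
proof -
  let ?E = "{(p, q) \<in> (X \<times> Y) \<times> (Z \<times> W). slope l m (fst p) (snd p) = slope k n (fst q) (snd q)}"
  define S where "S = (\<lambda>g. {(x, z) \<in> X \<times> Z. slope l m x (fst g) = slope k n z (snd g)})"
  have finS: "finite (S g)" for g
    unfolding S_def by (rule finite_subset[of _ "X \<times> Z"]) (use fin in auto)
  have "card ?E \<le> card (SIGMA g:Y \<times> W. S g)"
  proof (rule card_inj_on_le)
    show "inj_on (\<lambda>((x, y), (z, w)). ((y, w), (x, z))) ?E" by (auto simp: inj_on_def)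
    show "(\<lambda>((x, y), (z, w)). ((y, w), (x, z))) ` ?E \<subseteq> (SIGMA g:Y \<times> W. S g)"
      by (auto simp: S_def)
    show "finite (SIGMA g:Y \<times> W. S g)" using fin finS by auto
  qed
  also have "\<dots> = (\<Sum>g\<in>Y \<times> W. card (S g))"
    using fin finS by simp
  also have "\<dots> \<le> card (Y \<times> W) * (card X div b + card Z div b + 1) + 2 * ((card X * b) * (card Z * b))"
  proof (rule incidence_bound)
    show "S g \<subseteq> X \<times> Z" for g by (auto simp: S_def)
    fix g x z x' z' assume g: "g \<in> Y \<times> W" and m: "(x, z) \<in> S g" "(x', z') \<in> S g"
    have "x < x' \<longleftrightarrow> slope l m x' (fst g) < slope l m x (fst g)"
      by (rule slope_less_iff[OF lm, symmetric]) (use g m pos in \<open>auto simp: S_def\<close>)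
    also have "\<dots> \<longleftrightarrow> slope k n z' (snd g) < slope k n z (snd g)" using m by (simp add: S_def)
    also have "\<dots> \<longleftrightarrow> z < z'"
      by (rule slope_less_iff[OF kn]) (use g m pos in \<open>auto simp: S_def\<close>)
    finally show "x < x' \<longleftrightarrow> z < z'" .
  next
    fix p q assume p: "p \<in> X \<times> Z" and q: "q \<in> X \<times> Z" and pq: "p \<noteq> q"
    show "card {g \<in> Y \<times> W. p \<in> S g \<and> q \<in> S g} \<le> 2"
    proof (rule card_bilinear_curves_le_two
        [where \<alpha> = "l - k" and \<beta> = "l - n" and \<gamma> = "m - k" and \<delta> = "m - n"
          and x = "fst p" and z = "snd p" and x' = "fst q" and z' = "snd q"])
      have "(l - k) * (m - n) - (l - n) * (m - k) = (l - m) * (k - n)" by (simp add: algebra_simps)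
      with lm kn show "(l - k) * (m - n) \<noteq> (l - n) * (m - k)"
        by (metis cancel_comm_monoid_add_class.diff_cancel diff_eq_diff_eq less_irrefl mult_eq_0_iff)
      \<comment> \<open>If both products vanished, \<open>l\<close> and \<open>m\<close> would both
        lie in \<open>{k, n}\<close>, and the orderings would force
        \<open>(l, m) = (k, n)\<close>.\<close>
      show "(l - k) * (l - n) \<noteq> 0 \<or> (m - k) * (m - n) \<noteq> 0" using lm kn ne by auto
      show "(fst p, snd p) \<noteq> (fst q, snd q)" using pq by simp
      fix y w assume *: "(y, w) \<in> {g \<in> Y \<times> W. p \<in> S g \<and> q \<in> S g}"
      have "slope l m (fst p) y = slope k n (snd p) w" "slope l m (fst q) y = slope k n (snd q) w"
        using * by (auto simp: S_def)
      thus "(l - k) * fst p * snd p + (l - n) * fst p * w + (m - k) * y * snd p + (m - n) * y * w = 0 \<and>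
          (l - k) * fst q * snd q + (l - n) * fst q * w + (m - k) * y * snd q + (m - n) * y * w = 0"
        using * p q pos by (subst (asm) (1 2) slope_eq_iff) auto
    qed (use p q pos in auto)
  qed (use fin b in auto)
  also have "\<dots> = t\<^sup>2 * (2 * (t div b) + 1) + 2 * (t * b)\<^sup>2"
    using card by (simp add: card_cartesian_product power2_eq_square)
  finally show ?thesis .
qed

section \<open>Slopes produced by one cluster of lines\<close>

text \<open>Cauchy--Schwarz for the fibre sizes of \<open>g\<close>: they add up to
  \<open>card P\<close>, and their squares add up to the number of coincidences.\<close>

lemma card_squared_le_image_times_collisions:
  assumes "finite P"
  shows "(card P)\<^sup>2 \<le> card (g ` P) * card {(p, q) \<in> P \<times> P. g p = g q}"
proof -
  let ?F = "\<lambda>v. {p \<in> P. g p = v}"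
  have "card P = (\<Sum>v\<in>g ` P. card (?F v))"
    using sum.image_gen[OF assms, of "\<lambda>_. 1::nat" g] by simp
  moreover have "card {(p, q) \<in> P \<times> P. g p = g q} = (\<Sum>v\<in>g ` P. (card (?F v))\<^sup>2)"
  proof -
    have "{(p, q) \<in> P \<times> P. g p = g q} = (\<Union>v\<in>g ` P. ?F v \<times> ?F v)" by auto
    also have "card \<dots> = (\<Sum>v\<in>g ` P. card (?F v \<times> ?F v))"
      by (rule card_UN_disjoint) (use assms in auto)
    finally show ?thesis by (simp add: card_cartesian_product power2_eq_square)
  qed
  moreover have "(\<Sum>v\<in>g ` P. real (card (?F v)))\<^sup>2 \<le> (\<Sum>v\<in>g ` P. (real (card (?F v)))\<^sup>2) * real (card (g ` P))"
    by (rule sum_squared_le_sum_of_squares)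
  ultimately have "real ((card P)\<^sup>2) \<le> real (card (g ` P) * card {(p, q) \<in> P \<times> P. g p = g q})"
    by (simp add: mult.commute)
  thus ?thesis by (simp only: of_nat_le_iff)
qed

lemma card_increasing_pairs:
  fixes L :: "'a::linorder set"
  assumes "finite L"
  shows "2 * card {(l, m) \<in> L \<times> L. l < m} + card L = (card L)\<^sup>2"
proof -
  let ?P = "{(l, m) \<in> L \<times> L. l < m}" and ?Q = "{(l, m) \<in> L \<times> L. m < l}" and ?D = "(\<lambda>l. (l, l)) ` L"
  have fin: "finite ?P" "finite ?Q"
    by (rule finite_subset[of _ "L \<times> L"], use assms in auto)+
  have "?Q = prod.swap ` ?P" by auto
  hence Q: "card ?Q = card ?P" by (metis (no_types, lifting) card_image inj_swap)
  have "L \<times> L = (?P \<union> ?Q) \<union> ?D" by auto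
  hence "card (L \<times> L) = card ((?P \<union> ?Q) \<union> ?D)" by (rule arg_cong)
  also have "\<dots> = card (?P \<union> ?Q) + card ?D"
    by (rule card_Un_disjoint) (use assms fin in auto)
  also have "card (?P \<union> ?Q) = card ?P + card ?Q"
    by (rule card_Un_disjoint) (use assms fin in auto)
  also have "card ?D = card L" by (rule card_image) (auto simp: inj_on_def)
  finally show ?thesis using Q by (simp add: card_cartesian_product power2_eq_square)
qed

lemma card_cluster_slopes:
  fixes L :: "real set" and X :: "real \<Rightarrow> real set"
  assumes finL: "finite L" and M: "card L \<ge> 2" and Mt: "card L ^ 6 \<le> t"
    and X: "\<And>l. l \<in> L \<Longrightarrow> finite (X l) \<and> card (X l) = t \<and> (\<forall>x\<in>X l. x > 0)"
  shows "(card L)\<^sup>2 * t \<le> 14 * card {slope l m x y | l m x y. l \<in> L \<and> m \<in> L \<and> l < m \<and> x \<in> X l \<and> y \<in> X m}"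
proof -
  define M where "M = card L"
  define P where "P = {(l, m) \<in> L \<times> L. l < m}"
  define Pts where "Pts = (SIGMA lm:P. X (fst lm) \<times> X (snd lm))"
  define g where "g = (\<lambda>((l, m), (x, y)). slope l m x y)"
  define N where "N = (\<lambda>c d. {(p, q) \<in> (X (fst c) \<times> X (snd c)) \<times> (X (fst d) \<times> X (snd d)).
      slope (fst c) (snd c) (fst p) (snd p) = slope (fst d) (snd d) (fst q) (snd q)})"
  \<comment> \<open>The incidence bound with block side \<open>M\<^sup>2\<close>. Multiplied by
    \<open>M\<^sup>2\<close>, its main terms become at most \<open>2 * t ^ 3\<close> and
    \<open>2 * t\<^sup>2 * M ^ 6\<close>; the assumption \<open>M ^ 6 \<le> t\<close> brings the
    latter below \<open>2 * t ^ 3\<close> as well.\<close>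
  define Q where "Q = t\<^sup>2 * (2 * (t div M\<^sup>2) + 1) + 2 * (t * M\<^sup>2)\<^sup>2"
  have finP: "finite P"
    unfolding P_def by (rule finite_subset[of _ "L \<times> L"]) (use finL in auto)
  have PX: "finite (X (fst c))" "finite (X (snd c))" "card (X (fst c)) = t" "card (X (snd c)) = t"
    "fst c < snd c" "\<And>x. x \<in> X (fst c) \<union> X (snd c) \<Longrightarrow> x > 0" if "c \<in> P" for c
    using that X by (auto simp: P_def)
  have finPts: "finite Pts" using finP PX by (auto simp: Pts_def)
  have finN: "finite (N c d)" if "c \<in> P" "d \<in> P" for c d
    unfolding N_def
    by (rule finite_subset[of _ "(X (fst c) \<times> X (snd c)) \<times> (X (fst d) \<times> X (snd d))"])
       (use PX that in auto)
  have cardPts: "card Pts = card P * t\<^sup>2"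
    unfolding Pts_def using finP PX
    by (subst card_SigmaI) (auto simp: card_cartesian_product power2_eq_square)
  have Ndiag: "card (N c c) \<le> t ^ 3" if "c \<in> P" for c
    unfolding N_def by (rule card_slope_collisions_same) (use PX[OF that] in auto)
  have Noff: "card (N c d) \<le> Q" if "c \<in> P" "d \<in> P" "c \<noteq> d" for c d
    unfolding N_def Q_def
    by (rule card_slope_collisions_distinct)
       (use PX[OF that(1)] PX[OF that(2)] that(3) M in \<open>auto simp: M_def prod_eq_iff\<close>)
  have "card {(p, q) \<in> Pts \<times> Pts. g p = g q} \<le> card (SIGMA cd:P \<times> P. N (fst cd) (snd cd))"
  proof (rule card_inj_on_le)
    show "inj_on (\<lambda>((c, p), (d, q)). ((c, d), (p, q))) {(p, q) \<in> Pts \<times> Pts. g p = g q}"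
      by (auto simp: inj_on_def)
    show "(\<lambda>((c, p), (d, q)). ((c, d), (p, q))) ` {(p, q) \<in> Pts \<times> Pts. g p = g q}
        \<subseteq> (SIGMA cd:P \<times> P. N (fst cd) (snd cd))"
      by (auto simp: Pts_def N_def g_def)
    show "finite (SIGMA cd:P \<times> P. N (fst cd) (snd cd))" using finP finN by auto
  qed
  also have "\<dots> = (\<Sum>c\<in>P. \<Sum>d\<in>P. card (N c d))"
    using finP finN by (subst card_SigmaI) (auto simp: sum.cartesian_product split_def)
  \<comment> \<open>Adding \<open>Q\<close> on the diagonal too only weakens the bound and lets the
    double sum factor.\<close>
  also have "\<dots> \<le> (\<Sum>c\<in>P. \<Sum>d\<in>P. (if d = c then t ^ 3 else 0) + Q)"
    by (intro sum_mono) (auto intro: le_trans[OF Ndiag] Noff)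
  also have "\<dots> = card P * t ^ 3 + card P * (card P * Q)"
    using finP by (simp add: sum.distrib distrib_left)
  finally have E: "card {(p, q) \<in> Pts \<times> Pts. g p = g q} \<le> card P * t ^ 3 + card P * (card P * Q)" .
  have V: "g ` Pts = {slope l m x y | l m x y. l \<in> L \<and> m \<in> L \<and> l < m \<and> x \<in> X l \<and> y \<in> X m}" (is "_ = ?V")
    by (force simp: g_def Pts_def P_def)
  have pairs: "2 * card P + M = M\<^sup>2" unfolding P_def M_def by (rule card_increasing_pairs[OF finL])
  have M2: "M \<ge> 2" and M6: "M ^ 6 \<le> t" using M Mt by (auto simp: M_def)
  have "M * 2 \<le> M\<^sup>2" using M2 by (simp add: power2_eq_square)
  with pairs have p: "2 * card P \<le> M\<^sup>2" "M\<^sup>2 \<le> 4 * card P" by linarith+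
  have "M\<^sup>2 * Q \<le> 5 * t ^ 3"
  proof -
    have "M\<^sup>2 \<le> M ^ 6" using M2 by (intro power_increasing) auto
    hence "M\<^sup>2 \<le> t" using M6 by simp
    hence 1: "t\<^sup>2 * M\<^sup>2 \<le> t\<^sup>2 * t" by (rule mult_left_mono) simp
    have 2: "t\<^sup>2 * M ^ 6 \<le> t\<^sup>2 * t" by (rule mult_left_mono) (use M6 in auto)
    have 3: "t\<^sup>2 * (M\<^sup>2 * (t div M\<^sup>2)) \<le> t\<^sup>2 * t" by (rule mult_left_mono) auto
    have "M\<^sup>2 * Q = 2 * (t\<^sup>2 * (M\<^sup>2 * (t div M\<^sup>2))) + t\<^sup>2 * M\<^sup>2 + 2 * (t\<^sup>2 * M ^ 6)"
      by (simp add: Q_def algebra_simps power_mult_distrib flip: power_add power_mult)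
    with 1 2 3 have "M\<^sup>2 * Q \<le> 5 * (t\<^sup>2 * t)" by linarith
    thus ?thesis by (simp add: power3_eq_cube power2_eq_square)
  qed
  moreover have "2 * (card P * Q) \<le> M\<^sup>2 * Q" using mult_right_mono[OF p(1), of Q] by simp
  ultimately have pQ: "2 * (card P * Q) \<le> 5 * t ^ 3" by linarith
  have "(card P * t\<^sup>2)\<^sup>2 \<le> card ?V * (card P * t ^ 3 + card P * (card P * Q))"
    using card_squared_le_image_times_collisions[OF finPts, of g] E cardPts V
    by (metis (no_types, lifting) le_trans mult_le_mono2)
  hence "(card P * t ^ 3) * (2 * (card P * t)) \<le> 2 * (card ?V * (card P * t ^ 3 + card P * (card P * Q)))"
    by (simp add: power2_eq_square power3_eq_cube algebra_simps)
  also have "\<dots> = card ?V * card P * (2 * t ^ 3 + 2 * (card P * Q))"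
    by (simp add: algebra_simps)
  also have "\<dots> \<le> card ?V * card P * (7 * t ^ 3)"
    using pQ by (intro mult_left_mono) auto
  finally have "(card P * t ^ 3) * (2 * (card P * t)) \<le> (card P * t ^ 3) * (7 * card ?V)"
    by (simp add: algebra_simps)
  moreover have "card P * t ^ 3 > 0"
  proof -
    have "M ^ 6 > 0" "M\<^sup>2 > 0" using M2 by auto
    with M6 p show ?thesis by (metis mult_pos_pos gr0I le_zero_eq mult_0_right neq0_conv zero_less_power)
  qed
  ultimately have "2 * (card P * t) \<le> 7 * card ?V"
    by (simp only: mult_le_cancel1)
  \<comment> \<open>The constant 14 arises here: \<open>4 * card P * t\<close> is twice
    \<open>2 * (card P * t)\<close>, which is at most \<open>7 * card ?V\<close>.\<close>
  moreover have "M\<^sup>2 * t \<le> 4 * card P * t" using p(2) by (rule mult_right_mono) simp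
  ultimately show ?thesis unfolding M_def by linarith
qed

section \<open>Elementary properties of the two ratio sets\<close>

lemma finite_ratio_set: "finite A \<Longrightarrow> finite (ratio_set A)"
  by (rule finite_subset[of _ "(\<lambda>(a, b). a / b) ` (A \<times> A)"]) (auto simp: ratio_set_def)

lemma finite_sum_ratio_set: "finite A \<Longrightarrow> finite (sum_ratio_set A)"
  by (rule finite_subset[of _ "(\<lambda>(a, b, c, d). (a + b) / (c + d)) ` (A \<times> A \<times> A \<times> A)"])
     (force simp: sum_ratio_set_def)+

lemma ratio_set_mono: "A \<subseteq> B \<Longrightarrow> ratio_set A \<subseteq> ratio_set B"
  unfolding ratio_set_def by blast

lemma sum_ratio_set_mono: "A \<subseteq> B \<Longrightarrow> sum_ratio_set A \<subseteq> sum_ratio_set B"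
  unfolding sum_ratio_set_def by blast

lemma ratio_set_uminus: "ratio_set (uminus ` A) = ratio_set A"
proof -
  have "ratio_set (uminus ` B) \<subseteq> ratio_set B" for B
    unfolding ratio_set_def by (auto, blast)
  from this[of A] this[of "uminus ` A"] show ?thesis by (auto simp: image_image)
qed

lemma sum_ratio_set_uminus: "sum_ratio_set (uminus ` A) = sum_ratio_set A"
proof -
  have "sum_ratio_set (uminus ` B) \<subseteq> sum_ratio_set B" for B
  proof
    fix v assume "v \<in> sum_ratio_set (uminus ` B)"
    then obtain a b c d where *: "a \<in> B" "b \<in> B" "c \<in> B" "d \<in> B" "- c + - d \<noteq> 0" "v = (- a + - b) / (- c + - d)"
      unfolding sum_ratio_set_def by blast
    hence "v = (a + b) / (c + d)" by (simp add: divide_simps) (simp add: algebra_simps)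
    with * show "v \<in> sum_ratio_set B" unfolding sum_ratio_set_def by force
  qed
  from this[of A] this[of "uminus ` A"] show ?thesis by (auto simp: image_image)
qed

lemma ratio_set_subset_sum_ratio_set: "ratio_set A \<subseteq> sum_ratio_set A"
proof
  fix v assume "v \<in> ratio_set A"
  then obtain a b where "a \<in> A" "b \<in> A" "b \<noteq> 0" "v = a / b" by (auto simp: ratio_set_def)
  hence "v = (a + a) / (b + b)" "b + b \<noteq> 0" by (auto simp: field_simps)
  with \<open>a \<in> A\<close> \<open>b \<in> A\<close> show "v \<in> sum_ratio_set A" unfolding sum_ratio_set_def by blast
qed

section \<open>Lines through the origin with many points\<close>

text \<open>The abscissae of the points of \<open>A \<times> A\<close> on the line through the origin with slope \<open>l\<close>.\<close>

definition rep :: "real set \<Rightarrow> real \<Rightarrow> real set" where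
  "rep A l = {x \<in> A. l * x \<in> A}"

definition rich :: "real set \<Rightarrow> nat \<Rightarrow> real set" where
  "rich A t = {l \<in> ratio_set A. t \<le> card (rep A l)}"

lemma rep_subset: "rep A l \<subseteq> A" by (auto simp: rep_def)

text \<open>A point \<open>(x, y)\<close> of \<open>A \<times> A\<close> lies on exactly one of the
  lines, the one of slope \<open>y / x\<close>.\<close>

lemma sum_card_rep:
  assumes "finite A" and pos: "\<And>x. x \<in> A \<Longrightarrow> x > 0"
  shows "(\<Sum>l\<in>ratio_set A. card (rep A l)) = (card A)\<^sup>2"
proof -
  have "(\<Sum>l\<in>ratio_set A. card (rep A l)) = card (SIGMA l:ratio_set A. rep A l)"
    using assms finite_ratio_set finite_subset[OF rep_subset] by (subst card_SigmaI) auto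
  also have "\<dots> = card (A \<times> A)"
  proof (rule bij_betw_same_card)
    show "bij_betw (\<lambda>(l, x). (x, l * x)) (SIGMA l:ratio_set A. rep A l) (A \<times> A)"
    proof (rule bij_betw_byWitness[where f' = "\<lambda>(x, y). (y / x, x)"])
      show "\<forall>a\<in>SIGMA l:ratio_set A. rep A l. (\<lambda>(x, y). (y / x, x)) ((\<lambda>(l, x). (x, l * x)) a) = a"
        using pos by (force simp: rep_def)
      show "\<forall>a'\<in>A \<times> A. (\<lambda>(l, x). (x, l * x)) ((\<lambda>(x, y). (y / x, x)) a') = a'"
        using pos by force
      show "(\<lambda>(l, x). (x, l * x)) ` (SIGMA l:ratio_set A. rep A l) \<subseteq> A \<times> A"
        by (auto simp: rep_def)
      show "(\<lambda>(x, y). (y / x, x)) ` (A \<times> A) \<subseteq> (SIGMA l:ratio_set A. rep A l)"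
        using pos by (force simp: rep_def ratio_set_def)
    qed
  qed
  finally show ?thesis by (simp add: card_cartesian_product power2_eq_square)
qed

text \<open>Layer-cake summation: a line with \<open>r\<close> points is counted once at each of the
  levels \<open>1\<close> to \<open>r\<close>.\<close>

lemma sum_card_rich:
  assumes "finite A" and pos: "\<And>x. x \<in> A \<Longrightarrow> x > 0"
  shows "(\<Sum>t\<in>{1..card A}. card (rich A t)) = (card A)\<^sup>2"
proof -
  have "(\<Sum>t\<in>{1..card A}. card (rich A t)) = (\<Sum>l\<in>ratio_set A. card (rep A l))"
    unfolding rich_def
  proof (rule sum_multicount_gen)
    show "\<forall>l\<in>ratio_set A. card {t \<in> {1..card A}. t \<le> card (rep A l)} = card (rep A l)"
    proof
      fix l
      have "card (rep A l) \<le> card A" by (rule card_mono[OF assms(1) rep_subset])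
      hence "{t \<in> {1..card A}. t \<le> card (rep A l)} = {1..card (rep A l)}" by auto
      thus "card {t \<in> {1..card A}. t \<le> card (rep A l)} = card (rep A l)" by simp
    qed
  qed (use assms finite_ratio_set in auto)
  with sum_card_rep[OF assms] show ?thesis by simp
qed

section \<open>Pigeonholing a level of richness\<close>

lemma harm_le_one_plus_ln:
  assumes "n > 0"
  shows "harm n \<le> 1 + ln (real n)"
  using assms
proof (induction n rule: nat_induct_non_zero)
  case 1
  show ?case by (simp add: harm_def)
next
  case (Suc n)
  have "ln (real n / real (Suc n)) \<le> real n / real (Suc n) - 1"
    by (rule ln_le_minus_one) (use Suc in simp)
  hence "inverse (real (Suc n)) \<le> ln (real (Suc n)) - ln (real n)"
    using Suc by (simp add: ln_div field_simps)
  with Suc show ?case by (simp add: harm_Suc)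
qed

text \<open>Suppose every level fails. Levels below \<open>x0\<close> contribute at most
  \<open>x0 * q\<close>, half of \<open>n\<^sup>2\<close>, to the sum in
  \<open>sum_card_rich\<close>. From \<open>x0\<close> on, level \<open>t\<close> contributes less
  than \<open>c / t\<close>, in total at most \<open>c * harm n\<close>, a third of
  \<open>n\<^sup>2\<close>. The constants 2 and 3 work because \<open>1/2 + 1/3 < 1\<close>.\<close>

lemma rich_level:
  assumes "finite A" "A \<noteq> {}" and pos: "\<And>x. x \<in> A \<Longrightarrow> x > 0"
  shows "\<exists>t\<in>{1..card A}. (real (card A))\<^sup>2 / (2 * card (ratio_set A)) \<le> t \<and>
    (real (card A))\<^sup>2 / (3 * (1 + ln (card A))) \<le> card (rich A t) * t"
proof (rule ccontr)
  define n where "n = card A"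
  define q where "q = card (ratio_set A)"
  define x0 where "x0 = (real n)\<^sup>2 / (2 * q)"
  define c where "c = (real n)\<^sup>2 / (3 * (1 + ln n))"
  define T where "T = {t \<in> {1..n}. x0 \<le> t}"
  assume "\<not> ?thesis"
  hence T: "card (rich A t) * t < c" if "t \<in> T" for t
    using that by (auto simp: T_def c_def x0_def n_def q_def)
  have n: "n > 0" using assms by (auto simp: n_def card_gt_0_iff)
  obtain a where "a \<in> A" using assms by auto
  hence "a / a \<in> ratio_set A" using pos by (force simp: ratio_set_def)
  hence q: "q > 0" using assms finite_ratio_set by (auto simp: q_def card_gt_0_iff)
  have H: "1 + ln (real n) > 0" using n by (simp add: add_pos_nonneg)
  have c0: "c \<ge> 0" using H by (simp add: c_def)
  have "(real n)\<^sup>2 = (\<Sum>t\<in>{1..n}. real (card (rich A t)))"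
    using sum_card_rich[OF assms(1) pos] unfolding n_def
    by (metis of_nat_power of_nat_sum)
  also have "\<dots> = (\<Sum>t\<in>{1..n} - T. real (card (rich A t))) + (\<Sum>t\<in>T. real (card (rich A t)))"
    by (rule sum.subset_diff) (auto simp: T_def)
  also have "(\<Sum>t\<in>{1..n} - T. real (card (rich A t))) \<le> (\<Sum>t\<in>{1..n} - T. real q)"
    using finite_ratio_set[OF assms(1)]
    by (intro sum_mono) (auto simp: q_def rich_def intro!: card_mono)
  also have "\<dots> = real (card ({1..n} - T)) * q" by simp
  also have "\<dots> \<le> x0 * q"
  proof (rule mult_right_mono)
    have "x0 \<ge> 0" by (simp add: x0_def)
    have "{1..n} - T \<subseteq> {1..nat \<lfloor>x0\<rfloor>}"
    proof
      fix x assume "x \<in> {1..n} - T"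
      hence "1 \<le> x" "real x \<le> x0" by (auto simp: T_def)
      thus "x \<in> {1..nat \<lfloor>x0\<rfloor>}" using le_nat_floor by auto
    qed
    hence "card ({1..n} - T) \<le> card {1..nat \<lfloor>x0\<rfloor>}" by (intro card_mono) auto
    hence "card ({1..n} - T) \<le> nat \<lfloor>x0\<rfloor>" by simp
    with \<open>x0 \<ge> 0\<close> show "real (card ({1..n} - T)) \<le> x0" by linarith
  qed simp
  also have "\<dots> = (real n)\<^sup>2 / 2" using q by (simp add: x0_def)
  also have "(\<Sum>t\<in>T. real (card (rich A t))) \<le> (\<Sum>t\<in>T. c * inverse (real t))"
  proof (rule sum_mono)
    fix t assume t: "t \<in> T"
    hence "t > 0" by (auto simp: T_def)
    with T[OF t] show "real (card (rich A t)) \<le> c * inverse (real t)" by (simp add: field_simps)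
  qed
  also have "\<dots> \<le> (\<Sum>t\<in>{1..n}. c * inverse (real t))"
    using c0 by (intro sum_mono2) (auto simp: T_def)
  also have "\<dots> = c * harm n" by (simp add: harm_def sum_distrib_left)
  also have "\<dots> \<le> c * (1 + ln n)" by (rule mult_left_mono[OF harm_le_one_plus_ln[OF n] c0])
  also have "\<dots> = (real n)\<^sup>2 / 3"
  proof -
    have "y / (3 * h) * h = y / 3" if "h > 0" for y h :: real using that by simp
    from this[OF H] show ?thesis unfolding c_def .
  qed
  finally have "(real n)\<^sup>2 \<le> (real n)\<^sup>2 / 2 + (real n)\<^sup>2 / 3" by simp
  with n show False by (simp add: power2_eq_square)
qed

section \<open>Adding up the clusters\<close>

text \<open>Slopes from a cluster lie strictly between its extreme lines, so clusters of consecutive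
  lines occupy disjoint intervals and their contributions add. An incomplete last cluster is
  discarded, hence the \<open>div\<close>.\<close>

lemma card_clusters_le_sum_ratio_set:
  assumes finA: "finite A" and pos: "\<And>x. x \<in> A \<Longrightarrow> x > 0" and M: "M \<ge> 2" and Mt: "M ^ 6 \<le> t"
  shows "(card (rich A t) div M) * (M\<^sup>2 * t) \<le> 14 * card (sum_ratio_set A)"
proof -
  define L where "L = rich A t"
  have finL: "finite L" using finite_ratio_set[OF finA] by (simp add: L_def rich_def)
  \<comment> \<open>Each rich line is thinned to exactly \<open>t\<close> points, the uniform size
    that the cluster bound requires.\<close>
  have "\<exists>S. S \<subseteq> rep A l \<and> card S = t" if "l \<in> L" for l
    using that obtain_subset_with_card_n[of t "rep A l"] by (auto simp: L_def rich_def)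
  then obtain X where X: "\<And>l. l \<in> L \<Longrightarrow> X l \<subseteq> rep A l \<and> card (X l) = t" by metis
  have XA: "x \<in> A" "l * x \<in> A" "x > 0" if "l \<in> L" "x \<in> X l" for l x
    using X[OF that(1)] that(2) pos by (auto simp: rep_def)
  have finX: "finite (X l)" if "l \<in> L" for l
    by (rule finite_subset[OF _ finA]) (use XA that in auto)
  define B where "B = (\<lambda>k. {l \<in> L. rank_in L l div M = k})"
  define V where "V = (\<lambda>k. {slope l m x y | l m x y. l \<in> B k \<and> m \<in> B k \<and> l < m \<and> x \<in> X l \<and> y \<in> X m})"
  have V_sub: "V k \<subseteq> sum_ratio_set A" for k
  proof
    fix v assume "v \<in> V k"
    then obtain l m x y where *: "l \<in> L" "m \<in> L" "x \<in> X l" "y \<in> X m" "v = slope l m x y"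
      by (auto simp: V_def B_def)
    moreover have "x + y \<noteq> 0" using XA(3)[of l x] XA(3)[of m y] * by simp
    ultimately show "v \<in> sum_ratio_set A"
      unfolding sum_ratio_set_def slope_def using XA by blast
  qed
  have V_card: "M\<^sup>2 * t \<le> 14 * card (V k)" if "k < card L div M" for k
  proof -
    have "Suc k * M \<le> card L"
      using that by (meson Suc_leI div_times_less_eq_dividend le_trans mult_le_mono1)
    hence "card (B k) = M" unfolding B_def using finL M by (intro card_rank_block_eq) auto
    moreover have BL: "B k \<subseteq> L" by (auto simp: B_def)
    moreover have "finite (X l) \<and> card (X l) = t \<and> (\<forall>x\<in>X l. x > 0)" if "l \<in> B k" for l
      using that BL finX X XA(3) by blast
    ultimately show ?thesis
      using card_cluster_slopes[of "B k" t X] M Mt finite_subset[OF BL finL] unfolding V_def by simp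
  qed
  \<comment> \<open>A common slope \<open>v\<close> would satisfy \<open>l' < v < m\<close> with
    \<open>l'\<close> in the later block \<open>j\<close> and \<open>m\<close> in block
    \<open>i\<close>, against the order of ranks.\<close>
  have disj: "V i \<inter> V j = {}" if "i < j" for i j
  proof (rule ccontr)
    assume "V i \<inter> V j \<noteq> {}"
    then obtain v where v: "v \<in> V i" "v \<in> V j" by auto
    obtain l m x y where 1: "l \<in> B i" "m \<in> B i" "l < m" "x \<in> X l" "y \<in> X m" "v = slope l m x y"
      using v(1) by (auto simp: V_def)
    obtain l' m' x' y' where 2: "l' \<in> B j" "m' \<in> B j" "l' < m'" "x' \<in> X l'" "y' \<in> X m'" "v = slope l' m' x' y'"
      using v(2) by (auto simp: V_def)
    have "v < m" using 1 slope_between(2)[of l m x y] XA by (auto simp: B_def)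
    moreover have "l' < v" using 2 slope_between(1)[of l' m' x' y'] XA by (auto simp: B_def)
    ultimately have "rank_in L l' div M \<le> rank_in L m div M"
      using finL by (intro div_le_mono rank_in_mono) auto
    with 1 2 that show False by (simp add: B_def)
  qed
  have finV: "finite (V k)" for k
    by (rule finite_subset[OF V_sub finite_sum_ratio_set[OF finA]])
  have "(card L div M) * (M\<^sup>2 * t) = (\<Sum>k<card L div M. M\<^sup>2 * t)" by simp
  also have "\<dots> \<le> (\<Sum>k<card L div M. 14 * card (V k))"
    by (intro sum_mono V_card) auto
  also have "\<dots> = 14 * (\<Sum>k<card L div M. card (V k))" by (simp add: sum_distrib_left)
  also have "(\<Sum>k<card L div M. card (V k)) = card (\<Union>k<card L div M. V k)"
    by (rule card_UN_disjoint[symmetric]) (use finV disj in \<open>auto, metis IntI empty_iff linorder_neqE_nat\<close>)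
  also have "\<dots> \<le> card (sum_ratio_set A)"
    using V_sub by (intro card_mono finite_sum_ratio_set finA) auto
  finally show ?thesis by (simp add: L_def)
qed

section \<open>The bound for sets of positive numbers\<close>

lemma card_sum_ratio_set_pos:
  assumes finA: "finite A" and ne: "A \<noteq> {}" and pos: "\<And>x. x \<in> A \<Longrightarrow> x > 0"
  shows "real (card A) powr (2 + 1/4) \<le>
    6144 * (1 + ln (card A)) * real (card (ratio_set A)) powr (1/8) * card (sum_ratio_set A)"
proof -
  define n where "n = card A"
  define q where "q = card (ratio_set A)"
  define R where "R = card (sum_ratio_set A)"
  define H where "H = 1 + ln (real n)"
  obtain t where t: "t \<in> {1..n}" "(real n)\<^sup>2 / (2 * q) \<le> t" "(real n)\<^sup>2 / (3 * H) \<le> card (rich A t) * t"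
    using rich_level[OF finA ne pos] by (auto simp: n_def q_def H_def)
  define u where "u = real t powr (1/8)"
  define M where "M = nat \<lfloor>u\<rfloor>" \<comment> \<open>the cluster size; for \<open>M < 2\<close> the bound by the ratio set suffices\<close>
  define L where "L = card (rich A t)"
  have n: "n > 0" using ne finA by (auto simp: n_def card_gt_0_iff)
  obtain a where "a \<in> A" using ne by auto
  hence "a / a \<in> ratio_set A" using pos by (force simp: ratio_set_def)
  hence q: "q > 0" using finA finite_ratio_set by (auto simp: q_def card_gt_0_iff)
  have H: "H \<ge> 1" using n by (simp add: H_def)
  have u1: "u \<ge> 1" unfolding u_def using t(1) by (intro ge_one_powr_ge_zero) auto
  have u8: "u ^ 8 = t" unfolding u_def using t(1) by (simp add: powr_powr flip: powr_realpow)
  have M1: "M \<ge> 1" and Mu: "M \<le> u" and uM: "u < M + 1" using u1 by (simp_all add: M_def le_nat_floor) linarith+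
  have LQ: "L \<le> q" unfolding L_def q_def rich_def by (rule card_mono) (use finite_ratio_set[OF finA] in auto)
  have QR: "q \<le> R" unfolding q_def R_def
    by (rule card_mono[OF finite_sum_ratio_set[OF finA] ratio_set_subset_sum_ratio_set])
  \<comment> \<open>The constant is \<open>2 ^ 9\<close>, which covers \<open>u < 2\<close> because
    \<open>t * u = u ^ 9\<close>. The clusters alone would give 56.\<close>
  have main: "real L * t * u \<le> 512 * real R"
  proof (cases "M \<ge> 2")
    case False
    hence "u < 2" using uM by simp
    hence "u ^ 9 \<le> 2 ^ 9" using u1 by (intro power_mono) auto
    moreover have "t * u = u ^ 9" unfolding u8[symmetric] by (simp add: power_numeral_reduce)
    moreover have "real L \<le> R" using LQ QR by simp
    ultimately have "real L * (real t * u) \<le> real R * 512" using u1 by (intro mult_mono) auto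
    thus ?thesis by simp
  next
    case True
    have "real M ^ 6 \<le> u ^ 6" using Mu by (intro power_mono) auto
    also have "\<dots> \<le> u ^ 8" using u1 by (intro power_increasing) auto
    finally have "real (M ^ 6) \<le> real t" using u8 by simp
    hence Mt: "M ^ 6 \<le> t" by (simp only: of_nat_le_iff)
    \<comment> \<open>At least one cluster is complete, so rounding \<open>L / M\<close> down loses
      at most a factor 2. With \<open>v ^ 8 = n\<close> and \<open>H \<le> 8 * v\<close>, the choice
      of \<open>t\<close> gives \<open>v ^ 7 \<le> 24 * L\<close>, while \<open>v \<ge> 2\<close>
      gives \<open>64 * v \<le> v ^ 7\<close>.\<close>
    have "M \<le> L"
    proof -
      define v where "v = real n powr (1/8)"
      have v8: "v ^ 8 = n" unfolding v_def using n by (simp add: powr_powr flip: powr_realpow)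
      have uv: "u \<le> v" unfolding u_def v_def using t(1) by (intro powr_mono2) auto
      have v2: "v \<ge> 2" using uv Mu True by linarith
      have "ln (real n) = 8 * ln v" using v8[symmetric] v2 by (simp add: ln_realpow)
      moreover have "ln v \<le> v - 1" using v2 by (intro ln_le_minus_one) auto
      ultimately have Hv: "H \<le> 8 * v" by (simp add: H_def)
      have "(real n)\<^sup>2 \<le> real L * t * (3 * H)" using t(3) H by (simp add: L_def field_simps)
      also have "\<dots> \<le> real L * n * (3 * (8 * v))"
        using t(1) H Hv by (intro mult_mono) auto
      finally have "real n * n \<le> n * (24 * L * v)" by (simp add: power2_eq_square mult_ac)
      hence "real n \<le> 24 * L * v" using n by simp
      hence "v * v ^ 7 \<le> v * (24 * L)" using v8 by (simp add: mult_ac power_numeral_reduce)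
      hence v7: "v ^ 7 \<le> 24 * L" using v2 by simp
      have "2 ^ 6 \<le> v ^ 6" using v2 by (intro power_mono) auto
      hence "v * 64 \<le> v * v ^ 6" using v2 by (intro mult_left_mono) auto
      also have "\<dots> = v ^ 7" by (simp add: power_numeral_reduce)
      finally have "v \<le> L" using v7 v2 by linarith
      with uv Mu show "M \<le> L" by linarith
    qed
    have "L \<le> 2 * (M * (L div M))"
    proof -
      have "L div M \<ge> 1" using \<open>M \<le> L\<close> M1 by (simp add: div_greater_zero_iff Suc_le_eq)
      hence "M * 1 \<le> M * (L div M)" by (rule mult_le_mono2)
      moreover have "L mod M < M" using M1 by simp
      ultimately show ?thesis using mult_div_mod_eq[of M L] by linarith
    qed
    hence "L * (M * t) \<le> 2 * (M * (L div M)) * (M * t)" by (rule mult_right_mono) simp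
    also have "\<dots> = 2 * ((L div M) * (M\<^sup>2 * t))" by (simp add: power2_eq_square)
    also have "\<dots> \<le> 2 * (14 * R)"
      using card_clusters_le_sum_ratio_set[OF finA pos True Mt] unfolding L_def R_def by (simp only: mult_le_mono2)
    finally have "real (L * (M * t)) \<le> real (28 * R)" by (simp only: of_nat_le_iff)
    hence "real L * t * (2 * M) \<le> 56 * R" by simp
    moreover have "u \<le> 2 * M" using uM M1 by linarith
    hence "real L * t * u \<le> real L * t * (2 * M)" by (intro mult_left_mono) auto
    ultimately show ?thesis by linarith
  qed
  \<comment> \<open>The exponent is split as \<open>2 + 1/4\<close>: the factor
    \<open>n\<^sup>2\<close> is bounded through the number of rich lines, and the factor
    \<open>(n\<^sup>2) powr (1/8)\<close> through the lower bound on \<open>t\<close>, which brings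
    in \<open>q powr (1/8)\<close> and \<open>u\<close>.\<close>
  have "((real n)\<^sup>2) powr (1/8) = real n powr (1/4)"
    using n by (simp add: powr_powr flip: powr_numeral)
  hence "real n powr (2 + 1/4) = (real n)\<^sup>2 * ((real n)\<^sup>2) powr (1/8)"
    using n powr_add[of "real n" 2 "1/4"] by simp
  also have "\<dots> \<le> (real L * t * (3 * H)) * (2 * q * t) powr (1/8)"
  proof (rule mult_mono)
    show "(real n)\<^sup>2 \<le> real L * t * (3 * H)" using t(3) H by (simp add: L_def field_simps)
    have "(real n)\<^sup>2 \<le> 2 * q * t" using t(2) q by (simp add: field_simps)
    thus "((real n)\<^sup>2) powr (1/8) \<le> (2 * q * t) powr (1/8)" by (intro powr_mono2) auto
  qed (use H in auto)
  also have "(2 * q * t) powr (1/8) = 2 powr (1/8) * q powr (1/8) * u"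
    by (simp add: powr_mult u_def)
  also have "(real L * t * (3 * H)) * (2 powr (1/8) * q powr (1/8) * u)
      \<le> (real L * t * (3 * H)) * (2 * q powr (1/8) * u)"
  proof -
    have "(2::real) powr (1/8) \<le> 2 powr 1" by (intro powr_mono) auto
    thus ?thesis using H u1 by (intro mult_left_mono mult_right_mono) auto
  qed
  also have "\<dots> = (6 * H * q powr (1/8)) * (real L * t * u)" by simp
  also have "\<dots> \<le> (6 * H * q powr (1/8)) * (512 * real R)"
    using main H by (intro mult_left_mono) auto
  also have "\<dots> \<le> 6144 * H * q powr (1/8) * R" using H by simp
  finally show ?thesis by (simp add: n_def q_def R_def H_def)
qed

section \<open>Reduction to positive sets and conclusion\<close>

text \<open>Take the positive elements or the reflected negative ones, since reflection changes
  neither ratio set. If the positive part is below a quarter of \<open>A\<close>, then four times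
  the negative part exceeds \<open>3 * card A - 4\<close>, which is at least \<open>card A\<close>
  because \<open>card A \<ge> 2\<close>; this allows for a possible 0.\<close>

lemma large_one_signed_subset:
  fixes A :: "real set"
  assumes "finite A" "card A \<ge> 2"
  obtains B where "finite B" "B \<noteq> {}" "\<And>x. x \<in> B \<Longrightarrow> x > 0" "card A \<le> 4 * card B" "card B \<le> card A"
    "ratio_set B \<subseteq> ratio_set A" "sum_ratio_set B \<subseteq> sum_ratio_set A"
proof -
  define P N where "P = {x \<in> A. x > 0}" and "N = {x \<in> A. x < 0}"
  have fin: "finite P" "finite N" using assms by (auto simp: P_def N_def)
  have "card A \<le> card ((P \<union> N) \<union> {0})" using fin by (intro card_mono) (auto simp: P_def N_def)
  also have "\<dots> \<le> card P + card N + 1"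
    by (rule order_trans[OF card_Un_le]) (simp add: card_Un_le)
  finally have sz: "card A \<le> card P + card N + 1" .
  show thesis
  proof (cases "card A \<le> 4 * card P")
    case True
    show thesis
    proof (rule that[of P])
      show "P \<noteq> {}" using True assms(2) by auto
      show "card P \<le> card A" using assms by (auto simp: P_def intro: card_mono)
      show "ratio_set P \<subseteq> ratio_set A" by (rule ratio_set_mono) (auto simp: P_def)
      show "sum_ratio_set P \<subseteq> sum_ratio_set A" by (rule sum_ratio_set_mono) (auto simp: P_def)
    qed (use True fin P_def in auto)
  next
    case False
    have c: "card (uminus ` N) = card N" by (rule card_image) auto
    show thesis
    proof (rule that[of "uminus ` N"])
      show 4: "card A \<le> 4 * card (uminus ` N)" unfolding c using False sz assms(2) by linarith
      show "uminus ` N \<noteq> {}" using 4 assms(2) by auto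
      show "card (uminus ` N) \<le> card A" unfolding c using assms by (auto simp: N_def intro: card_mono)
      show "ratio_set (uminus ` N) \<subseteq> ratio_set A"
        unfolding ratio_set_uminus by (rule ratio_set_mono) (auto simp: N_def)
      show "sum_ratio_set (uminus ` N) \<subseteq> sum_ratio_set A"
        unfolding sum_ratio_set_uminus by (rule sum_ratio_set_mono) (auto simp: N_def)
    qed (use fin N_def in auto)
  qed
qed

text \<open>The bound for \<open>B\<close> passes to \<open>A\<close> by monotonicity in both ratio
  sets. The constants \<open>4 powr 3\<close>, 6144 and 3 multiply to 1179648, which is below
  \<open>2 ^ 21\<close>. The product form serves both halves of the theorem.\<close>

lemma card_sum_ratio_set_lower_bound:
  fixes A :: "real set"
  assumes "finite A" "card A \<ge> 2"
  shows "real (card A) powr (2 + 1/4) \<le>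
    2 ^ 21 * (real (card (ratio_set A)) powr (1/8) * ln (card A)) * card (sum_ratio_set A)"
proof -
  obtain B where B: "finite B" "B \<noteq> {}" "\<And>x. x \<in> B \<Longrightarrow> x > 0" "card A \<le> 4 * card B" "card B \<le> card A"
    and sub: "ratio_set B \<subseteq> ratio_set A" "sum_ratio_set B \<subseteq> sum_ratio_set A"
    using large_one_signed_subset[OF assms] by metis
  have B0: "card B > 0" using B by (auto simp: card_gt_0_iff)
  have q: "card (ratio_set B) \<le> card (ratio_set A)"
    by (rule card_mono[OF finite_ratio_set[OF assms(1)] sub(1)])
  have R: "card (sum_ratio_set B) \<le> card (sum_ratio_set A)"
    by (rule card_mono[OF finite_sum_ratio_set[OF assms(1)] sub(2)])
  have "ln 2 \<le> ln (real (card A))" using assms(2) by simp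
  \<comment> \<open>The summand 1 is absorbed because \<open>ln 2 \<ge> 2/3\<close>.\<close>
  hence ln: "1 + ln (real (card A)) \<le> 3 * ln (real (card A))" using ln2_ge_two_thirds by linarith
  have lnB: "0 \<le> ln (real (card B))" "ln (real (card B)) \<le> ln (real (card A))" using B0 B(5) by simp_all
  have "real (card A) powr (2 + 1/4) \<le> (4 * real (card B)) powr (2 + 1/4)"
    using B(4) by (intro powr_mono2) auto
  also have "\<dots> = 4 powr (2 + 1/4) * real (card B) powr (2 + 1/4)" by (simp add: powr_mult)
  also have "\<dots> \<le> 4 powr 3 * real (card B) powr (2 + 1/4)"
    by (intro mult_right_mono powr_mono) auto
  also have "\<dots> \<le> 4 powr 3 * (6144 * (1 + ln (card B)) * real (card (ratio_set B)) powr (1/8) * card (sum_ratio_set B))"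
    by (intro mult_left_mono card_sum_ratio_set_pos B) auto
  also have "\<dots> \<le> 4 powr 3 * (6144 * (3 * ln (card A)) * real (card (ratio_set A)) powr (1/8) * card (sum_ratio_set A))"
    using lnB ln q R by (intro mult_left_mono mult_mono powr_mono2) auto
  also have "\<dots> = 1179648 * (real (card (ratio_set A)) powr (1/8) * ln (card A) * card (sum_ratio_set A))"
    by simp
  also have "\<dots> \<le> 2 ^ 21 * (real (card (ratio_set A)) powr (1/8) * ln (card A) * card (sum_ratio_set A))"
    using lnB by (intro mult_right_mono) auto
  finally show ?thesis by (simp only: mult.assoc)
qed

theorem theorem1:
  "(\<exists>c::real. c > 0 \<and>
      (\<forall>A::real set. finite A \<and> card A \<ge> 2 \<longrightarrow>
         real (card (sum_ratio_set A)) \<ge>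
           c * (real (card A) powr (2 + 1/4) /
                 (real (card (ratio_set A)) powr (1/8) * ln (real (card A))))))
   \<and>
   (\<forall>C::real. C > 0 \<longrightarrow>
      (\<exists>c::real. c > 0 \<and>
         (\<forall>A::real set. finite A \<and> card A \<ge> 2 \<and>
              real (card (sum_ratio_set A)) \<le> C * real (card A) ^ 2 \<longrightarrow>
            real (card (ratio_set A)) \<ge>
              c * (real (card A) ^ 2 / ln (real (card A)) ^ 8))))"
proof (intro conjI allI impI)
  show "\<exists>c::real. c > 0 \<and> (\<forall>A::real set. finite A \<and> card A \<ge> 2 \<longrightarrow>
      real (card (sum_ratio_set A)) \<ge> c * (real (card A) powr (2 + 1/4) /
        (real (card (ratio_set A)) powr (1/8) * ln (real (card A)))))"
  proof (intro exI conjI allI impI)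
    show "(1 / 2 ^ 21 :: real) > 0" by simp
    fix A :: "real set" assume A: "finite A \<and> card A \<ge> 2"
    define D where "D = real (card (ratio_set A)) powr (1/8) * ln (card A)"
    have "D \<ge> 0" using A by (simp add: D_def)
    moreover have "real (card A) powr (2 + 1/4) \<le> 2 ^ 21 * D * card (sum_ratio_set A)"
      using card_sum_ratio_set_lower_bound A unfolding D_def by blast
    \<comment> \<open>In the case \<open>D = 0\<close> the quotient is 0 by the convention for
      division.\<close>
    ultimately have "1 / 2 ^ 21 * (real (card A) powr (2 + 1/4) / D) \<le> card (sum_ratio_set A)"
      by (cases "D = 0") (simp_all add: divide_simps mult_ac)
    thus "real (card (sum_ratio_set A)) \<ge> 1 / 2 ^ 21 * (real (card A) powr (2 + 1/4) /
        (real (card (ratio_set A)) powr (1/8) * ln (real (card A))))"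
      by (simp add: D_def)
  qed
next
  fix C :: real assume C: "C > 0"
  show "\<exists>c::real. c > 0 \<and> (\<forall>A::real set. finite A \<and> card A \<ge> 2 \<and>
      real (card (sum_ratio_set A)) \<le> C * real (card A) ^ 2 \<longrightarrow>
      real (card (ratio_set A)) \<ge> c * (real (card A) ^ 2 / ln (real (card A)) ^ 8))"
  proof (intro exI conjI allI impI)
    \<comment> \<open>After cancelling \<open>n\<^sup>2\<close>, the lower bound reads
      \<open>n powr (1/4) \<le> 2 ^ 21 * C * ln n * q powr (1/8)\<close>; its eighth power isolates
      \<open>q\<close> and yields this constant.\<close>
    show "1 / (2 ^ 21 * C) ^ 8 > 0" using C by simp
    fix A :: "real set"
    assume A: "finite A \<and> card A \<ge> 2 \<and> real (card (sum_ratio_set A)) \<le> C * real (card A) ^ 2"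
    define n q where "n = real (card A)" and "q = real (card (ratio_set A))"
    have n: "n \<ge> 2" using A by (simp add: n_def)
    have "n\<^sup>2 * n powr (1/4) = n powr (2 + 1/4)"
      using n powr_add[of n 2 "1/4"] by simp
    also have "\<dots> \<le> 2 ^ 21 * (q powr (1/8) * ln n) * card (sum_ratio_set A)"
      using card_sum_ratio_set_lower_bound A unfolding n_def q_def by blast
    also have "\<dots> \<le> 2 ^ 21 * (q powr (1/8) * ln n) * (C * n\<^sup>2)"
      using A n by (intro mult_left_mono) (auto simp: n_def)
    finally have "n\<^sup>2 * n powr (1/4) \<le> n\<^sup>2 * (2 ^ 21 * C * ln n * q powr (1/8))"
      by (simp add: mult_ac)
    hence "n powr (1/4) \<le> 2 ^ 21 * C * ln n * q powr (1/8)" using n by simp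
    hence "(n powr (1/4)) ^ 8 \<le> (2 ^ 21 * C * ln n * q powr (1/8)) ^ 8" by (intro power_mono) auto
    moreover have "(n powr (1/4)) ^ 8 = n\<^sup>2"
      using n by (simp add: powr_powr flip: powr_realpow powr_numeral)
    moreover have "(q powr (1/8)) ^ 8 = q"
      by (cases "q = 0") (simp_all add: q_def powr_powr flip: powr_realpow)
    ultimately have "n\<^sup>2 \<le> (2 ^ 21 * C) ^ 8 * ln n ^ 8 * q"
      by (simp only: power_mult_distrib)
    hence "1 / (2 ^ 21 * C) ^ 8 * (n\<^sup>2 / ln n ^ 8) \<le> q"
      using n C by (simp add: field_simps)
    thus "real (card (ratio_set A)) \<ge> 1 / (2 ^ 21 * C) ^ 8 * (real (card A) ^ 2 / ln (real (card A)) ^ 8)"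
      by (simp add: n_def q_def)
  qed
qed

end
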